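(* Let $G$ be a non-Archimedean, non-discrete locally compact abelian group with Haar measure $\mu$. Suppose that $\Omega\subset G$ is a bounded open set of the form $$\Omega=\bigsqcup_{n=1}^\infty (x_n+B_n)$$ (a disjoint union), where $x_n\in G$ and $B_n$ are compact open subgroups of $G$, satisfying (1) $B_n\supset B_{n+1}$ for all $n\ge1$; (2) $\displaystyle\limsup_{n\to\infty}\mathcal{N}_{B_n}(\Omega_n)=+\infty$, where $\Omega_n:=\bigsqcup_{k=n+1}^\infty(x_k+B_k)$. Then there does not exist any subset $\Lambda\subset\widehat{G}$ which forms a Riesz basis for $L^2(\Omega)$.
   Context: All groups are Polish (separable and completely metrizable). A locally compact abelian group is an abelian topological group whose topology is Hausdorff and in which every point has a compact neighborhood. A Polish group is non-Archimedean if it admits a compatible left-invariant ultrametric (equivalently, the identity has a neighborhood basis consisting of open subgroups). A subset of $G$ is bounded if it is contained in a compact subset of $G$. $\widehat{G}$ is the group of characters of $G$, i.e. continuous group homomorphisms $G\to\mathbb{T}=\{z\in\mathbb{C}:|z|=1\}$. $L^2(\Omega)$ is taken with respect to $\mu$ restricted to $\Omega$. The inclusion $\supset$ is not necessarily strict. For a Borel set $S\subset G$, a translation set of $S$ is a set $T\subset G$ with $0\in T$ such that the translates $\{S+t\}_{t\in T}$ are pairwise disjoint up to Haar measure zero, i.e. $\mu((S+t)\cap(S+t'))=0$ for distinct $t,t'\in T$. For a compact open subgroup $B$ of $G$, the $B$-translation number of $S$ is $$\mathcal{N}_B(S):=\max\{\#T:\ 0\in T\subset B,\ T\text{ is a translation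 set of }S\}.$$ A countable family $\{f_n\}$ in a separable Hilbert space $\mathcal{H}$ is a Riesz basis if $f_n=Te_n$ for all $n$, for some bounded invertible operator $T:\mathcal{H}\to\mathcal{H}$ and some orthonormal basis $\{e_n\}$ of $\mathcal{H}$; equivalently, $\{f_n\}$ is complete in $\mathcal{H}$ and there is $K>0$ with $\frac1K\sum_n|a_n|^2\le\|\sum_n a_nf_n\|^2\le K\sum_n|a_n|^2$ for all square-summable $\{a_n\}\subset\mathbb{C}$. A set $\Lambda\subset\widehat{G}$ forms a Riesz basis for $L^2(\Omega)$ if the family of restrictions to $\Omega$ of the characters in $\Lambda$ (indexed by $\Lambda$) is a Riesz basis of $L^2(\Omega)$. *)

theory Defs
  imports "HOL-Analysis.Analysis"
begin

section \<open>Non-Archimedean groups and Haar measure\<close>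

text \<open>The ultrametric \<open>d\<close> is unrelated to the metric \<open>dist\<close> of the type class; it only has to
  induce the same topology.\<close>

definition non_archimedean :: "'a::topological_group_add itself \<Rightarrow> bool" where
  "non_archimedean _ \<longleftrightarrow>
     (\<exists>d :: 'a \<Rightarrow> 'a \<Rightarrow> real.
        Metric_space UNIV d \<and>
        Metric_space.mtopology UNIV d = euclidean \<and>
        (\<forall>x y z. d x z \<le> max (d x y) (d y z)) \<and>
        (\<forall>g x y. d (g + x) (g + y) = d x y))"

definition haar_measure :: "'a::topological_ab_group_add measure \<Rightarrow> bool" where
  "haar_measure \<mu> \<longleftrightarrow>
     sets \<mu> = sets borel \<and>
     emeasure \<mu> UNIV \<noteq> 0 \<and>
     (\<forall>K. compact K \<and> K \<in> sets borel \<longrightarrow> emeasure \<mu> K < \<infinity>) \<and>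
     (\<forall>A \<in> sets borel. emeasure \<mu> A = (INF U\<in>{U. open U \<and> A \<subseteq> U}. emeasure \<mu> U)) \<and>
     (\<forall>U. open U \<longrightarrow> emeasure \<mu> U =
        (SUP K\<in>{K. compact K \<and> K \<in> sets borel \<and> K \<subseteq> U}. emeasure \<mu> K)) \<and>
     (\<forall>g. \<forall>A \<in> sets borel. emeasure \<mu> ((+) g ` A) = emeasure \<mu> A)"

definition add_subgroup :: "'a::group_add set \<Rightarrow> bool" where
  "add_subgroup H \<longleftrightarrow> 0 \<in> H \<and> (\<forall>x\<in>H. \<forall>y\<in>H. x + y \<in> H) \<and> (\<forall>x\<in>H. - x \<in> H)"

definition characters :: "('a::topological_ab_group_add \<Rightarrow> complex) set" where
  "characters = {h. continuous_on UNIV h \<and> (\<forall>x. cmod (h x) = 1) \<and>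
                (\<forall>x y. h (x + y) = h x * h y)}"

section \<open>Translation numbers\<close>

definition translation_set :: "'a::ab_group_add measure \<Rightarrow> 'a set \<Rightarrow> 'a set \<Rightarrow> bool" where
  "translation_set \<mu> S T \<longleftrightarrow>
     0 \<in> T \<and> (\<forall>t\<in>T. \<forall>t'\<in>T. t \<noteq> t' \<longrightarrow> emeasure \<mu> ((+) t ` S \<inter> (+) t' ` S) = 0)"

definition cardinality :: "'a set \<Rightarrow> enat" where
  "cardinality T = (if finite T then enat (card T) else \<infinity>)"

text \<open>The maximum is rendered as a supremum in \<^typ>\<open>enat\<close>. The set of cardinalities is nonempty
  for \<open>0 \<in> B\<close> (take \<open>T = {0}\<close>), so the supremum is attained whenever it is finite.\<close>

definition translation_number :: "'a::ab_group_add measure \<Rightarrow> 'a set \<Rightarrow> 'a set \<Rightarrow> enat" where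
  "translation_number \<mu> B S = (SUP T\<in>{T. T \<subseteq> B \<and> translation_set \<mu> S T}. cardinality T)"

section \<open>Riesz bases of \<open>L\<^sup>2\<close>\<close>

text \<open>The Hilbert space \<open>L\<^sup>2(M)\<close> is handled through representatives: its elements are square
  integrable functions, and equality in \<open>L\<^sup>2(M)\<close> is equality almost everywhere.\<close>

definition L2 :: "'a measure \<Rightarrow> ('a \<Rightarrow> complex) set" where
  "L2 M = {f \<in> borel_measurable M. integrable M (\<lambda>x. (cmod (f x))\<^sup>2)}"

definition L2_inner :: "'a measure \<Rightarrow> ('a \<Rightarrow> complex) \<Rightarrow> ('a \<Rightarrow> complex) \<Rightarrow> complex" where
  "L2_inner M f g = (LINT x|M. f x * cnj (g x))"

definition L2_norm :: "'a measure \<Rightarrow> ('a \<Rightarrow> complex) \<Rightarrow> real" where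
  "L2_norm M f = sqrt (LINT x|M. (cmod (f x))\<^sup>2)"

definition L2_orthonormal_basis :: "'a measure \<Rightarrow> 'i set \<Rightarrow> ('i \<Rightarrow> 'a \<Rightarrow> complex) \<Rightarrow> bool" where
  "L2_orthonormal_basis M I e \<longleftrightarrow>
     (\<forall>i\<in>I. e i \<in> L2 M) \<and>
     (\<forall>i\<in>I. \<forall>j\<in>I. L2_inner M (e i) (e j) = (if i = j then 1 else 0)) \<and>
     (\<forall>f\<in>L2 M. \<forall>\<epsilon>>0. \<exists>F c. finite F \<and> F \<subseteq> I \<and>
        L2_norm M (\<lambda>x. f x - (\<Sum>i\<in>F. c i * e i x)) < \<epsilon>)"

text \<open>Linearity almost everywhere and boundedness together imply that \<open>T\<close> respects equality almost
  everywhere, so that \<open>T\<close> is an operator on \<open>L\<^sup>2(M)\<close> itself.\<close>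

definition L2_bounded_operator ::
    "'a measure \<Rightarrow> (('a \<Rightarrow> complex) \<Rightarrow> ('a \<Rightarrow> complex)) \<Rightarrow> bool" where
  "L2_bounded_operator M T \<longleftrightarrow>
     (\<forall>f\<in>L2 M. T f \<in> L2 M) \<and>
     (\<forall>f\<in>L2 M. \<forall>g\<in>L2 M. \<forall>a b.
        AE x in M. T (\<lambda>y. a * f y + b * g y) x = a * T f x + b * T g x) \<and>
     (\<exists>C. \<forall>f\<in>L2 M. L2_norm M (T f) \<le> C * L2_norm M f)"

definition L2_bounded_invertible_operator ::
    "'a measure \<Rightarrow> (('a \<Rightarrow> complex) \<Rightarrow> ('a \<Rightarrow> complex)) \<Rightarrow> bool" where
  "L2_bounded_invertible_operator M T \<longleftrightarrow>
     L2_bounded_operator M T \<and>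
     (\<exists>S. L2_bounded_operator M S \<and>
          (\<forall>f\<in>L2 M. (AE x in M. S (T f) x = f x) \<and> (AE x in M. T (S f) x = f x)))"

definition L2_riesz_basis :: "'a measure \<Rightarrow> 'i set \<Rightarrow> ('i \<Rightarrow> 'a \<Rightarrow> complex) \<Rightarrow> bool" where
  "L2_riesz_basis M I f \<longleftrightarrow>
     countable I \<and>
     (\<forall>i\<in>I. f i \<in> L2 M) \<and>
     (\<exists>e T. L2_orthonormal_basis M I e \<and> L2_bounded_invertible_operator M T \<and>
        (\<forall>i\<in>I. AE x in M. f i x = T (e i) x))"

text \<open>A set of characters is viewed as a family indexed by itself; on \<^term>\<open>restrict_space \<mu> \<Omega>\<close>
  only the values of the characters on \<open>\<Omega>\<close> matter.\<close>

definition forms_riesz_basis ::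
    "'a::topological_ab_group_add measure \<Rightarrow> 'a set \<Rightarrow> ('a \<Rightarrow> complex) set \<Rightarrow> bool" where
  "forms_riesz_basis \<mu> \<Omega> \<Lambda> \<longleftrightarrow> L2_riesz_basis (restrict_space \<mu> \<Omega>) \<Lambda> (\<lambda>h. h)"

end

theory Submission
  imports Defs
begin

text \<open>A large translation number forces a Riesz basis of characters of \<open>\<Omega>\<close> to be a Riesz sequence
  already on a smaller set, and a Riesz sequence on a proper part of \<open>\<Omega>\<close> cannot be complete on
  \<open>\<Omega>\<close>.

  Let \<open>K\<close> be a Riesz constant, fix \<open>n\<close>, put \<open>H = B n\<close> and split \<open>\<Omega> = E \<union> R\<close>, where \<open>E\<close> consists of
  the first \<open>n\<close> cosets and \<open>R\<close> of the remaining ones. Since \<open>H\<close> is contained in \<open>B k\<close> for \<open>1 \<le> k \<le> n\<close>,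
  the set \<open>E\<close> is invariant under \<open>H\<close>. Group the characters by their restriction to \<open>H\<close> and let \<open>f\<close>
  be a finite sum of characters of one class, with coefficients \<open>c\<close>. Two facts about \<open>f\<close> compete:

  \<^item> \<open>\<bar>f\<bar>\<close> is invariant under \<open>H\<close>. If \<open>N\<close> translates of \<open>R\<close> by elements of \<open>H\<close> are disjoint, then they
    carry \<open>N\<close> times the energy \<open>\<integral>\<^sub>R \<bar>f\<bar>\<^sup>2\<close>.
  \<^item> A translation multiplies the coefficients of \<open>f\<close> by numbers of modulus one, so the upper Riesz
    bound holds on every translate of \<open>\<Omega>\<close>, and hence, up to the number of translates that are needed,
    on every bounded set. The translates of \<open>R\<close> lie in one compact set independent of \<open>n\<close>, so their
    total energy is at most a fixed multiple of \<open>\<Sum> \<bar>c h\<bar>\<^sup>2\<close>.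

  For large \<open>N\<close> the energy on \<open>R\<close> is therefore a small fraction of \<open>\<Sum> \<bar>c h\<bar>\<^sup>2\<close>, and the lower Riesz
  bound must come from \<open>E\<close>: the class is a Riesz sequence on \<open>E\<close>, with a constant that does not
  depend on the class. Distinct classes are orthogonal on \<open>E\<close>, because \<open>E\<close> is \<open>H\<close>-invariant, so the
  bound passes to arbitrary finite sums (\<open>char_sum_lower_bound_off_packed_part\<close>). But then a sum that
  approximates the indicator of a coset in \<open>R\<close> is small on \<open>E\<close>, hence has small coefficients, hence is
  small on \<open>\<Omega>\<close>, and cannot approximate the indicator after all
  (\<open>incomplete_if_lower_bound_on_part\<close>).

  All estimates concern finite sums of characters, which are continuous functions.\<close>

section \<open>Square-integrable functions\<close>

lemma borel_measurable_cnj: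
  "f \<in> borel_measurable M \<Longrightarrow> (\<lambda>x. cnj (f x)) \<in> borel_measurable M"
  by (rule measurable_compose[OF _ borel_measurable_continuous_onI]) (auto intro: continuous_intros)

lemma cmod_add_sq_le: "(cmod (u + v))\<^sup>2 \<le> 2 * (cmod u)\<^sup>2 + 2 * (cmod v)\<^sup>2"
proof -
  have "(cmod (u + v))\<^sup>2 \<le> (cmod u + cmod v)\<^sup>2"
    by (intro power_mono norm_triangle_ineq norm_ge_zero)
  moreover have "2 * cmod u * cmod v \<le> (cmod u)\<^sup>2 + (cmod v)\<^sup>2"
    by (rule sum_squares_bound)
  ultimately show ?thesis
    by (simp add: power2_sum)
qed

lemma L2_lincomb:
  assumes "f \<in> L2 M" "g \<in> L2 M"
  shows "(\<lambda>x. a * f x + b * g x) \<in> L2 M"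
proof -
  have [measurable]: "f \<in> borel_measurable M" "g \<in> borel_measurable M"
    and i: "integrable M (\<lambda>x. (cmod (f x))\<^sup>2)" "integrable M (\<lambda>x. (cmod (g x))\<^sup>2)"
    using assms by (auto simp: L2_def)
  have "integrable M (\<lambda>x. 2 * (cmod a)\<^sup>2 * (cmod (f x))\<^sup>2 + 2 * (cmod b)\<^sup>2 * (cmod (g x))\<^sup>2)"
    using i by auto
  then have "integrable M (\<lambda>x. (cmod (a * f x + b * g x))\<^sup>2)"
  proof (rule Bochner_Integration.integrable_bound)
    show "AE x in M. norm ((cmod (a * f x + b * g x))\<^sup>2)
        \<le> norm (2 * (cmod a)\<^sup>2 * (cmod (f x))\<^sup>2 + 2 * (cmod b)\<^sup>2 * (cmod (g x))\<^sup>2)"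
    proof (rule AE_I2)
      fix x show "norm ((cmod (a * f x + b * g x))\<^sup>2)
        \<le> norm (2 * (cmod a)\<^sup>2 * (cmod (f x))\<^sup>2 + 2 * (cmod b)\<^sup>2 * (cmod (g x))\<^sup>2)"
        using cmod_add_sq_le[of "a * f x" "b * g x"]
        by (simp add: norm_mult power_mult_distrib mult.assoc)
    qed
  qed simp
  then show ?thesis by (simp add: L2_def)
qed

lemma L2_zero: "(\<lambda>x. 0) \<in> L2 M"
  by (simp add: L2_def)

lemma L2_sum:
  assumes "finite F" "\<And>i. i \<in> F \<Longrightarrow> f i \<in> L2 M"
  shows "(\<lambda>x. \<Sum>i\<in>F. c i * f i x) \<in> L2 M"
  using assms
proof (induction F rule: finite_induct)
  case empty
  then show ?case by (simp add: L2_zero)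
next
  case (insert i F)
  then have "(\<lambda>x. c i * f i x + 1 * (\<Sum>i\<in>F. c i * f i x)) \<in> L2 M"
    by (intro L2_lincomb) auto
  with insert show ?case by simp
qed

lemma L2_diff: "f \<in> L2 M \<Longrightarrow> g \<in> L2 M \<Longrightarrow> (\<lambda>x. f x - g x) \<in> L2 M"
  using L2_lincomb[of f M g 1 "-1"] by simp

lemma L2_mult_cnj_integrable:
  assumes "f \<in> L2 M" "g \<in> L2 M"
  shows "integrable M (\<lambda>x. f x * cnj (g x))"
proof -
  have [measurable]: "f \<in> borel_measurable M" "g \<in> borel_measurable M"
    and i: "integrable M (\<lambda>x. (cmod (f x))\<^sup>2)" "integrable M (\<lambda>x. (cmod (g x))\<^sup>2)"
    using assms by (auto simp: L2_def)
  have "integrable M (\<lambda>x. (cmod (f x))\<^sup>2 + (cmod (g x))\<^sup>2)"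
    using i by auto
  then show ?thesis
  proof (rule Bochner_Integration.integrable_bound)
    show "AE x in M. norm (f x * cnj (g x)) \<le> norm ((cmod (f x))\<^sup>2 + (cmod (g x))\<^sup>2)"
    proof (rule AE_I2)
      fix x
      have "2 * cmod (f x) * cmod (g x) \<le> (cmod (f x))\<^sup>2 + (cmod (g x))\<^sup>2"
        by (rule sum_squares_bound)
      moreover have "0 \<le> cmod (f x) * cmod (g x)" by simp
      ultimately have "cmod (f x) * cmod (g x) \<le> (cmod (f x))\<^sup>2 + (cmod (g x))\<^sup>2" by linarith
      then show "norm (f x * cnj (g x)) \<le> norm ((cmod (f x))\<^sup>2 + (cmod (g x))\<^sup>2)"
        by (simp add: norm_mult)
    qed
  qed (intro borel_measurable_times borel_measurable_cnj; simp)
qed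

lemma L2_norm_nonneg: "0 \<le> L2_norm M f"
  by (simp add: L2_norm_def)

lemma L2_norm_power2: "(L2_norm M f)\<^sup>2 = (LINT x|M. (cmod (f x))\<^sup>2)"
  by (simp add: L2_norm_def)

lemma L2_norm_cong_AE:
  assumes "f \<in> L2 M" "g \<in> L2 M" "AE x in M. f x = g x"
  shows "L2_norm M f = L2_norm M g"
proof -
  have [measurable]: "f \<in> borel_measurable M" "g \<in> borel_measurable M"
    using assms by (auto simp: L2_def)
  have "(LINT x|M. (cmod (f x))\<^sup>2) = (LINT x|M. (cmod (g x))\<^sup>2)"
    using assms(3) by (intro integral_cong_AE) auto
  then show ?thesis by (simp add: L2_norm_def)
qed

text \<open>This crude substitute for the triangle inequality suffices, since the argument below only compares
  squared norms up to constants.\<close>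

lemma L2_norm_add_power2_le:
  assumes "f \<in> L2 M" "g \<in> L2 M"
  shows "(L2_norm M (\<lambda>x. f x + g x))\<^sup>2 \<le> 2 * (L2_norm M f)\<^sup>2 + 2 * (L2_norm M g)\<^sup>2"
proof -
  have i: "integrable M (\<lambda>x. (cmod (f x))\<^sup>2)" "integrable M (\<lambda>x. (cmod (g x))\<^sup>2)"
    using assms by (auto simp: L2_def)
  have "(LINT x|M. (cmod (f x + g x))\<^sup>2) \<le> (LINT x|M. 2 * (cmod (f x))\<^sup>2 + 2 * (cmod (g x))\<^sup>2)"
    using L2_lincomb[OF assms, of 1 1] i
    by (intro integral_mono cmod_add_sq_le) (auto simp: L2_def)
  also have "\<dots> = 2 * (LINT x|M. (cmod (f x))\<^sup>2) + 2 * (LINT x|M. (cmod (g x))\<^sup>2)"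
    using i by simp
  finally show ?thesis by (simp add: L2_norm_power2)
qed

lemma L2_inner_self: "L2_inner M f f = complex_of_real ((L2_norm M f)\<^sup>2)"
  unfolding L2_inner_def L2_norm_power2 complex_norm_square[symmetric] of_real_power[symmetric]
  by (rule integral_complex_of_real)

lemma L2_pythagoras:
  assumes "finite I" and L2: "\<And>i. i \<in> I \<Longrightarrow> f i \<in> L2 M"
    and orth: "\<And>i j. i \<in> I \<Longrightarrow> j \<in> I \<Longrightarrow> i \<noteq> j \<Longrightarrow> L2_inner M (f i) (f j) = 0"
  shows "(L2_norm M (\<lambda>x. \<Sum>i\<in>I. f i x))\<^sup>2 = (\<Sum>i\<in>I. (L2_norm M (f i))\<^sup>2)"
proof -
  have "complex_of_real ((L2_norm M (\<lambda>x. \<Sum>i\<in>I. f i x))\<^sup>2)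
      = (LINT x|M. (\<Sum>i\<in>I. \<Sum>j\<in>I. f i x * cnj (f j x)))"
    unfolding L2_inner_self[symmetric] L2_inner_def
    by (simp add: sum_product)
  also have "\<dots> = (\<Sum>i\<in>I. \<Sum>j\<in>I. L2_inner M (f i) (f j))"
    unfolding L2_inner_def
    by (simp add: Bochner_Integration.integral_sum Bochner_Integration.integrable_sum
        L2_mult_cnj_integrable L2)
  also have "\<dots> = (\<Sum>i\<in>I. \<Sum>j\<in>I. if j = i then L2_inner M (f i) (f i) else 0)"
    using orth by (intro sum.cong refl) auto
  also have "\<dots> = (\<Sum>i\<in>I. L2_inner M (f i) (f i))"
    using \<open>finite I\<close> by (simp add: sum.delta)
  also have "\<dots> = complex_of_real (\<Sum>i\<in>I. (L2_norm M (f i))\<^sup>2)"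
    by (simp add: L2_inner_self)
  finally show ?thesis using of_real_eq_iff by blast
qed

section \<open>Riesz bases through finite sums\<close>

lemma L2_bounded_operator_linear:
  assumes "L2_bounded_operator M T" "f \<in> L2 M" "g \<in> L2 M"
  shows "AE x in M. T (\<lambda>y. a * f y + b * g y) x = a * T f x + b * T g x"
  using assms unfolding L2_bounded_operator_def by simp

lemma L2_bounded_operator_sum:
  assumes T: "L2_bounded_operator M T" and "finite F" and "\<And>i. i \<in> F \<Longrightarrow> e i \<in> L2 M"
  shows "AE x in M. T (\<lambda>y. \<Sum>i\<in>F. c i * e i y) x = (\<Sum>i\<in>F. c i * T (e i) x)"
  using assms(2,3)
proof (induction F rule: finite_induct)
  case empty
  have "AE x in M. T (\<lambda>y. 0 * (0::complex) + 0 * 0) x = 0 * T (\<lambda>x. 0) x + 0 * T (\<lambda>x. 0) x"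
    by (rule L2_bounded_operator_linear[OF T L2_zero L2_zero])
  then show ?case by simp
next
  case (insert i F)
  have "(\<lambda>y. \<Sum>i\<in>F. c i * e i y) \<in> L2 M"
    using insert by (intro L2_sum) auto
  then have "AE x in M. T (\<lambda>y. c i * e i y + 1 * (\<Sum>i\<in>F. c i * e i y)) x
      = c i * T (e i) x + 1 * T (\<lambda>y. \<Sum>i\<in>F. c i * e i y) x"
    using insert.prems by (intro L2_bounded_operator_linear[OF T]) auto
  moreover have "AE x in M. T (\<lambda>y. \<Sum>i\<in>F. c i * e i y) x = (\<Sum>i\<in>F. c i * T (e i) x)"
    using insert by auto
  ultimately show ?case
  proof eventually_elim
    case (elim x)
    then show ?case using insert.hyps by simp
  qed
qed

lemma L2_bounded_operator_pos_bound:
  assumes "L2_bounded_operator M T"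
  obtains C where "C > 0" "\<And>f. f \<in> L2 M \<Longrightarrow> L2_norm M (T f) \<le> C * L2_norm M f"
proof -
  obtain C where C: "\<forall>f\<in>L2 M. L2_norm M (T f) \<le> C * L2_norm M f"
    using assms unfolding L2_bounded_operator_def by blast
  have "L2_norm M (T f) \<le> (\<bar>C\<bar> + 1) * L2_norm M f" if "f \<in> L2 M" for f
  proof -
    have "C * L2_norm M f \<le> (\<bar>C\<bar> + 1) * L2_norm M f"
      by (intro mult_right_mono L2_norm_nonneg) auto
    with C that show ?thesis by force
  qed
  then show thesis using that[of "\<bar>C\<bar> + 1"] by simp
qed

text \<open>The form in which the Riesz basis property is used: two-sided bounds for finite sums, and density
  of their span. All three are transported from the orthonormal basis \<open>e\<close> along the operator \<open>T\<close>:
  the upper bound and density by boundedness of \<open>T\<close>, the lower bound by boundedness of its inverse.\<close>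

lemma L2_riesz_basis_finite_sums:
  assumes "L2_riesz_basis M I f"
  obtains K where "K > 0"
    and "\<And>F c. finite F \<Longrightarrow> F \<subseteq> I \<Longrightarrow>
      (L2_norm M (\<lambda>x. \<Sum>i\<in>F. c i * f i x))\<^sup>2 \<le> K * (\<Sum>i\<in>F. (cmod (c i))\<^sup>2)"
    and "\<And>F c. finite F \<Longrightarrow> F \<subseteq> I \<Longrightarrow>
      (\<Sum>i\<in>F. (cmod (c i))\<^sup>2) \<le> K * (L2_norm M (\<lambda>x. \<Sum>i\<in>F. c i * f i x))\<^sup>2"
    and "\<And>g \<epsilon>. g \<in> L2 M \<Longrightarrow> \<epsilon> > 0 \<Longrightarrow> \<exists>F c. finite F \<and> F \<subseteq> I \<and>
      L2_norm M (\<lambda>x. g x - (\<Sum>i\<in>F. c i * f i x)) < \<epsilon>"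
proof -
  obtain e T S where fL2: "\<And>i. i \<in> I \<Longrightarrow> f i \<in> L2 M"
    and onb: "L2_orthonormal_basis M I e"
    and T: "L2_bounded_operator M T" and S: "L2_bounded_operator M S"
    and inv: "\<And>g. g \<in> L2 M \<Longrightarrow> (AE x in M. S (T g) x = g x) \<and> (AE x in M. T (S g) x = g x)"
    and feq: "\<And>i. i \<in> I \<Longrightarrow> AE x in M. f i x = T (e i) x"
    using assms unfolding L2_riesz_basis_def L2_bounded_invertible_operator_def by blast
  have eL2: "\<And>i. i \<in> I \<Longrightarrow> e i \<in> L2 M"
    and orth: "\<And>i j. i \<in> I \<Longrightarrow> j \<in> I \<Longrightarrow> L2_inner M (e i) (e j) = (if i = j then 1 else 0)"
    and dense: "\<And>g \<epsilon>. g \<in> L2 M \<Longrightarrow> \<epsilon> > 0 \<Longrightarrow> \<exists>F c. finite F \<and> F \<subseteq> I \<and>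
        L2_norm M (\<lambda>x. g x - (\<Sum>i\<in>F. c i * e i x)) < \<epsilon>"
    using onb unfolding L2_orthonormal_basis_def by blast+
  have TL2: "\<And>g. g \<in> L2 M \<Longrightarrow> T g \<in> L2 M" and SL2: "\<And>g. g \<in> L2 M \<Longrightarrow> S g \<in> L2 M"
    using T S unfolding L2_bounded_operator_def by blast+
  obtain C where C: "C > 0" "\<And>g. g \<in> L2 M \<Longrightarrow> L2_norm M (T g) \<le> C * L2_norm M g"
    using L2_bounded_operator_pos_bound[OF T] by blast
  obtain C' where C': "C' > 0" "\<And>g. g \<in> L2 M \<Longrightarrow> L2_norm M (S g) \<le> C' * L2_norm M g"
    using L2_bounded_operator_pos_bound[OF S] by blast
  have esum: "(\<lambda>x. \<Sum>i\<in>F. c i * e i x) \<in> L2 M" and fsum: "(\<lambda>x. \<Sum>i\<in>F. c i * f i x) \<in> L2 M"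
    if "finite F" "F \<subseteq> I" for F c
    using that eL2 fL2 by (auto intro!: L2_sum)
  \<comment> \<open>For finite sums Parseval's identity is Pythagoras' theorem.\<close>
  have parseval: "(L2_norm M (\<lambda>x. \<Sum>i\<in>F. c i * e i x))\<^sup>2 = (\<Sum>i\<in>F. (cmod (c i))\<^sup>2)"
    if F: "finite F" "F \<subseteq> I" for F c
  proof -
    have inner: "L2_inner M (\<lambda>x. c i * e i x) (\<lambda>x. c j * e j x)
        = c i * cnj (c j) * L2_inner M (e i) (e j)" for i j
      unfolding L2_inner_def by (simp add: mult.assoc mult.left_commute[of _ "cnj _"] 
          flip: integral_mult_right_zero)
    have "(L2_norm M (\<lambda>x. c i * e i x))\<^sup>2 = (cmod (c i))\<^sup>2" if "i \<in> F" for i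
    proof -
      have "complex_of_real ((L2_norm M (\<lambda>x. c i * e i x))\<^sup>2) = complex_of_real ((cmod (c i))\<^sup>2)"
        unfolding L2_inner_self[symmetric] inner
        using that F orth[of i i] by (simp add: complex_norm_square subset_eq del: of_real_power)
      then show ?thesis using of_real_eq_iff by blast
    qed
    moreover have "(\<lambda>x. c i * e i x) \<in> L2 M" if "i \<in> F" for i
      using L2_lincomb[OF eL2 L2_zero, of i "c i" 0] that F by auto
    moreover have "L2_inner M (\<lambda>x. c i * e i x) (\<lambda>x. c j * e j x) = 0"
      if "i \<in> F" "j \<in> F" "i \<noteq> j" for i j
      using orth[of i j] that F by (auto simp: inner)
    ultimately show ?thesis
      using L2_pythagoras[of F "\<lambda>i x. c i * e i x" M] F by simp
  qed
  have Tsum: "AE x in M. T (\<lambda>x. \<Sum>i\<in>F. c i * e i x) x = (\<Sum>i\<in>F. c i * f i x)"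
    if F: "finite F" "F \<subseteq> I" for F c
  proof -
    have "AE x in M. \<forall>i\<in>F. f i x = T (e i) x"
      using F feq by (subst AE_finite_all) auto
    moreover have "AE x in M. T (\<lambda>x. \<Sum>i\<in>F. c i * e i x) x = (\<Sum>i\<in>F. c i * T (e i) x)"
      using F eL2 by (intro L2_bounded_operator_sum[OF T]) auto
    ultimately show ?thesis by eventually_elim simp
  qed
  have Tnorm: "L2_norm M (T (\<lambda>x. \<Sum>i\<in>F. c i * e i x)) = L2_norm M (\<lambda>x. \<Sum>i\<in>F. c i * f i x)"
    if F: "finite F" "F \<subseteq> I" for F c
    using Tsum[OF F] esum[OF F] fsum[OF F] TL2 by (intro L2_norm_cong_AE) auto
  have upper: "(L2_norm M (\<lambda>x. \<Sum>i\<in>F. c i * f i x))\<^sup>2 \<le> C\<^sup>2 * (\<Sum>i\<in>F. (cmod (c i))\<^sup>2)"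
    if F: "finite F" "F \<subseteq> I" for F c
  proof -
    have "(L2_norm M (\<lambda>x. \<Sum>i\<in>F. c i * f i x))\<^sup>2 \<le> (C * L2_norm M (\<lambda>x. \<Sum>i\<in>F. c i * e i x))\<^sup>2"
      using C(2)[OF esum[OF F]] Tnorm[OF F] by (intro power_mono L2_norm_nonneg) auto
    then show ?thesis by (simp add: power_mult_distrib parseval[OF F])
  qed
  have lower: "(\<Sum>i\<in>F. (cmod (c i))\<^sup>2) \<le> C'\<^sup>2 * (L2_norm M (\<lambda>x. \<Sum>i\<in>F. c i * f i x))\<^sup>2"
    if F: "finite F" "F \<subseteq> I" for F c
  proof -
    let ?g = "\<lambda>x. \<Sum>i\<in>F. c i * e i x"
    have "L2_norm M ?g = L2_norm M (S (T ?g))"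
      using inv[OF esum[OF F]] esum[OF F] TL2 SL2 by (intro L2_norm_cong_AE) (auto simp: eq_commute)
    also have "\<dots> \<le> C' * L2_norm M (T ?g)"
      using C'(2) TL2 esum[OF F] by blast
    finally have "(L2_norm M ?g)\<^sup>2 \<le> (C' * L2_norm M (T ?g))\<^sup>2"
      by (intro power_mono L2_norm_nonneg)
    then show ?thesis by (simp add: power_mult_distrib parseval[OF F] Tnorm[OF F])
  qed
  have complete: "\<exists>F c. finite F \<and> F \<subseteq> I \<and> L2_norm M (\<lambda>x. g x - (\<Sum>i\<in>F. c i * f i x)) < \<epsilon>"
    if g: "g \<in> L2 M" and "\<epsilon> > 0" for g \<epsilon>
  proof -
    obtain F c where F: "finite F" "F \<subseteq> I"
      and less: "L2_norm M (\<lambda>x. S g x - (\<Sum>i\<in>F. c i * e i x)) < \<epsilon> / C"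
      using dense[OF SL2[OF g], of "\<epsilon> / C"] \<open>\<epsilon> > 0\<close> C(1) by auto
    let ?r = "\<lambda>x. 1 * S g x + (-1) * (\<Sum>i\<in>F. c i * e i x)"
    have r: "?r \<in> L2 M"
      by (intro L2_lincomb SL2 g esum F)
    have "AE x in M. T ?r x = 1 * T (S g) x + (-1) * T (\<lambda>x. \<Sum>i\<in>F. c i * e i x) x"
      by (rule L2_bounded_operator_linear[OF T SL2[OF g] esum[OF F]])
    with Tsum[OF F, of c] conjunct2[OF inv[OF g]]
    have "AE x in M. g x - (\<Sum>i\<in>F. c i * f i x) = T ?r x"
      by eventually_elim simp
    then have "L2_norm M (\<lambda>x. g x - (\<Sum>i\<in>F. c i * f i x)) = L2_norm M (T ?r)"
      by (intro L2_norm_cong_AE L2_diff g fsum F TL2 r)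
    also have "\<dots> \<le> C * L2_norm M ?r"
      by (rule C(2)[OF r])
    also have "\<dots> < \<epsilon>"
      using less C(1) by (simp add: field_simps)
    finally show ?thesis using F by blast
  qed
  show thesis
  proof (rule that[of "max (C\<^sup>2) (C'\<^sup>2)"])
    show "max (C\<^sup>2) (C'\<^sup>2) > 0" using C(1) by (simp add: less_max_iff_disj)
    show "(L2_norm M (\<lambda>x. \<Sum>i\<in>F. c i * f i x))\<^sup>2 \<le> max (C\<^sup>2) (C'\<^sup>2) * (\<Sum>i\<in>F. (cmod (c i))\<^sup>2)"
      if F: "finite F" "F \<subseteq> I" for F c
      by (rule order_trans[OF upper[OF F]]) (intro mult_right_mono sum_nonneg, auto)
    show "(\<Sum>i\<in>F. (cmod (c i))\<^sup>2) \<le> max (C\<^sup>2) (C'\<^sup>2) * (L2_norm M (\<lambda>x. \<Sum>i\<in>F. c i * f i x))\<^sup>2"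
      if F: "finite F" "F \<subseteq> I" for F c
      by (rule order_trans[OF lower[OF F]]) (intro mult_right_mono, auto)
  qed (use complete in blast)
qed

section \<open>Translates\<close>

lemma translate_eq_vimage: "(+) t ` A = (\<lambda>x. - t + x) -` (A :: 'a::group_add set)"
proof (intro set_eqI iffI)
  fix x assume "x \<in> (\<lambda>x. - t + x) -` A"
  then show "x \<in> (+) t ` A" by (intro image_eqI[of _ _ "- t + x"]) (auto simp: add.assoc[symmetric])
qed (auto simp: add.assoc[symmetric])

lemma continuous_on_translate: "continuous_on UNIV (\<lambda>x. t + x :: 'a::topological_ab_group_add)"
  by (intro continuous_intros)

lemma open_translate: "open A \<Longrightarrow> open ((+) (t :: 'a::topological_ab_group_add) ` A)"
  unfolding translate_eq_vimage by (rule open_vimage[OF _ continuous_on_translate])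

lemma compact_translate: "compact A \<Longrightarrow> compact ((+) (t :: 'a::topological_ab_group_add) ` A)"
  by (intro compact_continuous_image continuous_on_subset[OF continuous_on_translate]) auto

lemma borel_measurable_translate:
  "(\<lambda>x. t + x :: 'a::topological_ab_group_add) \<in> borel_measurable borel"
  by (intro borel_measurable_continuous_onI continuous_on_translate)

lemma borel_translate:
  "A \<in> sets borel \<Longrightarrow> (+) (t :: 'a::topological_ab_group_add) ` A \<in> sets borel"
  unfolding translate_eq_vimage by (rule measurable_sets_borel[OF borel_measurable_translate])

lemma translate_eq_if_invariant:
  assumes "\<And>h. h \<in> H \<Longrightarrow> (+) h ` E \<subseteq> E" and "add_subgroup H" and "(h :: 'a::group_add) \<in> H"
  shows "(+) h ` E = E"
proof
  show "(+) h ` E \<subseteq> E" using assms by blast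
  have "- h \<in> H" using assms by (auto simp: add_subgroup_def)
  then have "(+) (- h) ` E \<subseteq> E" using assms by blast
  then show "E \<subseteq> (+) h ` E" unfolding translate_eq_vimage[of h] by auto
qed

section \<open>Energy of continuous functions on bounded sets\<close>

definition bounded_borel :: "'a::topological_space set \<Rightarrow> bool" where
  "bounded_borel A \<longleftrightarrow> A \<in> sets borel \<and> (\<exists>K. compact K \<and> A \<subseteq> K)"

definition energy :: "'a measure \<Rightarrow> 'a set \<Rightarrow> ('a \<Rightarrow> complex) \<Rightarrow> real" where
  "energy \<mu> A f = (L2_norm (restrict_space \<mu> A) f)\<^sup>2"

lemma energy_cong: "(\<And>x. x \<in> A \<Longrightarrow> cmod (f x) = cmod (g x)) \<Longrightarrow> energy \<mu> A f = energy \<mu> A g"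
  unfolding energy_def L2_norm_power2
  by (intro Bochner_Integration.integral_cong refl) (simp add: space_restrict_space)

lemma bounded_borel_translate:
  "bounded_borel A \<Longrightarrow> bounded_borel ((+) (t :: 'a::topological_ab_group_add) ` A)"
  unfolding bounded_borel_def by (meson borel_translate compact_translate image_mono)

lemma bounded_borel_subset:
  "bounded_borel B \<Longrightarrow> A \<in> sets borel \<Longrightarrow> A \<subseteq> B \<Longrightarrow> bounded_borel A"
  unfolding bounded_borel_def by blast

lemma compact_bounded_borel: "compact (A :: 'a::t2_space set) \<Longrightarrow> bounded_borel A"
  unfolding bounded_borel_def using borel_compact by blast

context
  fixes \<mu> :: "'a::{polish_space, topological_ab_group_add} measure"
  assumes haar: "haar_measure \<mu>"
begin

lemma sets_haar [simp, measurable_cong]: "sets \<mu> = sets borel"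
  using haar by (simp add: haar_measure_def)

lemma space_haar [simp]: "space \<mu> = UNIV"
  using sets_eq_imp_space_eq[OF sets_haar] by simp

lemma emeasure_translate: "A \<in> sets borel \<Longrightarrow> emeasure \<mu> ((+) t ` A) = emeasure \<mu> A"
  using haar by (simp add: haar_measure_def)

text \<open>Invariance of Haar measure as an equation between measures, so that the change of variables formula
  for image measures applies.\<close>

lemma distr_translate: "distr \<mu> \<mu> (\<lambda>x. t + x) = \<mu>"
proof (rule measure_eqI)
  fix A assume "A \<in> sets (distr \<mu> \<mu> (\<lambda>x. t + x))"
  then have A: "A \<in> sets borel" by simp
  have m: "(\<lambda>x. t + x) \<in> measurable \<mu> \<mu>"
    using borel_measurable_translate by (simp cong: measurable_cong_sets)
  have "(\<lambda>x. t + x) -` A = (+) (- t) ` A"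
    unfolding translate_eq_vimage by simp
  then have "emeasure (distr \<mu> \<mu> (\<lambda>x. t + x)) A = emeasure \<mu> ((+) (- t) ` A)"
    using A m by (simp add: emeasure_distr)
  then show "emeasure (distr \<mu> \<mu> (\<lambda>x. t + x)) A = emeasure \<mu> A"
    using emeasure_translate[OF A, of "- t"] by simp
qed simp

lemma integral_restrict_haar:
  fixes f :: "'a \<Rightarrow> 'b::{banach, second_countable_topology}"
  assumes "A \<in> sets borel"
  shows "integral\<^sup>L (restrict_space \<mu> A) f = (LINT x|\<mu>. indicator A x *\<^sub>R f x)"
  using assms by (subst integral_restrict_space) auto

lemma integral_translate:
  fixes f :: "'a \<Rightarrow> 'b::{banach, second_countable_topology}"
  assumes A: "A \<in> sets borel" and f: "f \<in> borel_measurable borel"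
  shows "integral\<^sup>L (restrict_space \<mu> ((+) t ` A)) f = integral\<^sup>L (restrict_space \<mu> A) (\<lambda>x. f (t + x))"
proof -
  let ?g = "\<lambda>x. indicator ((+) t ` A) x *\<^sub>R f x"
  have m: "(\<lambda>x. t + x) \<in> measurable \<mu> \<mu>"
    using borel_measurable_translate by (simp cong: measurable_cong_sets)
  have g: "?g \<in> borel_measurable \<mu>"
    using f borel_translate[OF A, of t] by (simp cong: measurable_cong_sets)
  have "integral\<^sup>L \<mu> ?g = integral\<^sup>L (distr \<mu> \<mu> (\<lambda>x. t + x)) ?g"
    by (simp add: distr_translate)
  also have "\<dots> = (LINT x|\<mu>. ?g (t + x))"
    by (rule integral_distr[OF m g])
  also have "\<dots> = (LINT x|\<mu>. indicator A x *\<^sub>R f (t + x))"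
    by (intro Bochner_Integration.integral_cong refl) (auto simp: indicator_def)
  finally show ?thesis
    using A by (simp add: integral_restrict_haar borel_translate)
qed

lemma energy_translate:
  assumes "A \<in> sets borel" and "continuous_on UNIV f"
  shows "energy \<mu> ((+) t ` A) f = energy \<mu> A (\<lambda>x. f (t + x))"
proof -
  have [measurable]: "f \<in> borel_measurable borel"
    by (intro borel_measurable_continuous_onI assms)
  show ?thesis
    unfolding energy_def L2_norm_power2 by (intro integral_translate assms) simp
qed

text \<open>On a bounded set a continuous function is bounded and Haar measure is finite. Hence no integrability
  question arises for sums of characters.\<close>

lemma L2_continuous:
  assumes A: "bounded_borel A" and f: "continuous_on UNIV (f :: 'a \<Rightarrow> complex)"
  shows "f \<in> L2 (restrict_space \<mu> A)"
proof -
  have f_borel [measurable]: "f \<in> borel_measurable borel"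
    by (intro borel_measurable_continuous_onI f)
  obtain K where K: "compact K" "A \<subseteq> K" and AB [measurable]: "A \<in> sets borel"
    using A unfolding bounded_borel_def by blast
  have [measurable]: "K \<in> sets borel" using K(1) borel_compact by blast
  have fin: "emeasure \<mu> K < \<infinity>"
    using haar K(1) borel_compact[OF K(1)] unfolding haar_measure_def by blast
  have "compact (f ` K)"
    by (intro compact_continuous_image K continuous_on_subset[OF f]) auto
  then obtain b where b: "\<And>x. x \<in> K \<Longrightarrow> cmod (f x) \<le> b"
    using compact_imp_bounded bounded_iff by (metis imageI)
  have "integrable \<mu> (\<lambda>x. b\<^sup>2 * indicator K x)"
    using fin by (intro integrable_mult_right integrable_real_indicator) auto
  then have "integrable \<mu> (\<lambda>x. indicator A x *\<^sub>R (cmod (f x))\<^sup>2)"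
  proof (rule Bochner_Integration.integrable_bound)
    show "AE x in \<mu>. norm (indicator A x *\<^sub>R (cmod (f x))\<^sup>2) \<le> norm (b\<^sup>2 * indicator K x)"
    proof (rule AE_I2)
      fix x
      have "(cmod (f x))\<^sup>2 \<le> b\<^sup>2" if "x \<in> A"
        using b that K by (intro power_mono) auto
      then show "norm (indicator A x *\<^sub>R (cmod (f x))\<^sup>2) \<le> norm (b\<^sup>2 * indicator K x :: real)"
        using K(2) by (auto simp: indicator_def)
    qed
  qed simp
  then have "integrable (restrict_space \<mu> A) (\<lambda>x. (cmod (f x))\<^sup>2)"
    by (subst integrable_restrict_space) auto
  then show ?thesis
    unfolding L2_def by (auto intro!: measurable_restrict_space1)
qed

lemma energy_eq: "A \<in> sets borel \<Longrightarrow> energy \<mu> A f = (LINT x|\<mu>. indicator A x *\<^sub>R (cmod (f x))\<^sup>2)"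
  by (simp add: energy_def L2_norm_power2 integral_restrict_haar)

lemma energy_integrable:
  assumes "bounded_borel A" and "continuous_on UNIV f"
  shows "integrable \<mu> (\<lambda>x. indicator A x *\<^sub>R (cmod (f x))\<^sup>2)"
  using L2_continuous[OF assms] assms(1)
  by (auto simp: L2_def bounded_borel_def integrable_restrict_space)

lemma sum_energy_eq:
  assumes "\<And>i. i \<in> I \<Longrightarrow> bounded_borel (A i)" and "continuous_on UNIV f"
  shows "(LINT x|\<mu>. (\<Sum>i\<in>I. indicator (A i) x *\<^sub>R (cmod (f x))\<^sup>2)) = (\<Sum>i\<in>I. energy \<mu> (A i) f)"
proof -
  have "(LINT x|\<mu>. (\<Sum>i\<in>I. indicator (A i) x *\<^sub>R (cmod (f x))\<^sup>2))
      = (\<Sum>i\<in>I. LINT x|\<mu>. indicator (A i) x *\<^sub>R (cmod (f x))\<^sup>2)"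
    by (rule Bochner_Integration.integral_sum) (rule energy_integrable[OF assms])
  also have "\<dots> = (\<Sum>i\<in>I. energy \<mu> (A i) f)"
    using assms(1) by (intro sum.cong refl energy_eq[symmetric]) (auto simp: bounded_borel_def)
  finally show ?thesis .
qed

lemma energy_le_sum_cover:
  assumes "finite I" and A: "\<And>i. i \<in> I \<Longrightarrow> bounded_borel (A i)"
    and D: "D \<in> sets borel" and cover: "D \<subseteq> (\<Union>i\<in>I. A i)" and f: "continuous_on UNIV f"
  shows "energy \<mu> D f \<le> (\<Sum>i\<in>I. energy \<mu> (A i) f)"
proof -
  have "energy \<mu> D f \<le> (LINT x|\<mu>. (\<Sum>i\<in>I. indicator (A i) x *\<^sub>R (cmod (f x))\<^sup>2))"
    unfolding energy_eq[OF D]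
  proof (rule integral_mono')
    show "integrable \<mu> (\<lambda>x. \<Sum>i\<in>I. indicator (A i) x *\<^sub>R (cmod (f x))\<^sup>2)"
      by (intro Bochner_Integration.integrable_sum energy_integrable A f)
    fix x
    show "indicator D x *\<^sub>R (cmod (f x))\<^sup>2 \<le> (\<Sum>i\<in>I. indicator (A i) x *\<^sub>R (cmod (f x))\<^sup>2)"
    proof (cases "x \<in> D")
      case True
      then obtain i where "i \<in> I" "x \<in> A i" using cover by blast
      then have "indicator D x *\<^sub>R (cmod (f x))\<^sup>2 = indicator (A i) x *\<^sub>R (cmod (f x))\<^sup>2"
        using True by simp
      also have "\<dots> \<le> (\<Sum>i\<in>I. indicator (A i) x *\<^sub>R (cmod (f x))\<^sup>2)"
        using \<open>i \<in> I\<close> by (intro member_le_sum \<open>finite I\<close>) auto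
      finally show ?thesis .
    qed (simp add: sum_nonneg)
  qed (simp add: sum_nonneg)
  also have "\<dots> = (\<Sum>i\<in>I. energy \<mu> (A i) f)"
    by (rule sum_energy_eq[OF A f])
  finally show ?thesis .
qed

lemma energy_mono:
  assumes "bounded_borel D" "A \<in> sets borel" "A \<subseteq> D" "continuous_on UNIV f"
  shows "energy \<mu> A f \<le> energy \<mu> D f"
  using energy_le_sum_cover[of "{()}" "\<lambda>_. D" A f] assms by simp

text \<open>Overlaps of measure zero do not matter: outside a null set every point lies in at most one of the
  sets \<open>A i\<close>.\<close>

lemma sum_energy_le_packing:
  assumes "finite I" and A: "\<And>i. i \<in> I \<Longrightarrow> A i \<in> sets borel" and sub: "\<And>i. i \<in> I \<Longrightarrow> A i \<subseteq> D"
    and null: "\<And>i j. i \<in> I \<Longrightarrow> j \<in> I \<Longrightarrow> i \<noteq> j \<Longrightarrow> emeasure \<mu> (A i \<inter> A j) = 0"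
    and D: "bounded_borel D" and f: "continuous_on UNIV f"
  shows "(\<Sum>i\<in>I. energy \<mu> (A i) f) \<le> energy \<mu> D f"
proof -
  have bA: "bounded_borel (A i)" if "i \<in> I" for i
    using bounded_borel_subset[OF D] A sub that by blast
  have DB: "D \<in> sets borel" using D by (simp add: bounded_borel_def)
  have "AE x in \<mu>. i \<noteq> j \<longrightarrow> x \<notin> A i \<inter> A j" if "i \<in> I" "j \<in> I" for i j
  proof (cases "i = j")
    case False
    then have "A i \<inter> A j \<in> null_sets \<mu>"
      using null A that by (auto simp: null_sets_def)
    from AE_not_in[OF this] show ?thesis by eventually_elim simp
  qed simp
  then have "AE x in \<mu>. \<forall>i\<in>I. \<forall>j\<in>I. i \<noteq> j \<longrightarrow> x \<notin> A i \<inter> A j"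
    using \<open>finite I\<close> by (intro AE_finite_allI) auto
  then have "AE x in \<mu>. (\<Sum>i\<in>I. indicator (A i) x *\<^sub>R (cmod (f x))\<^sup>2)
      \<le> indicator D x *\<^sub>R (cmod (f x))\<^sup>2"
  proof eventually_elim
    case (elim x)
    show ?case
    proof (cases "\<exists>i\<in>I. x \<in> A i")
      case True
      then obtain i where i: "i \<in> I" "x \<in> A i" by blast
      have "(\<Sum>j\<in>I. indicator (A j) x *\<^sub>R (cmod (f x))\<^sup>2)
          = (\<Sum>j\<in>I. if j = i then (cmod (f x))\<^sup>2 else 0)"
        using elim i by (intro sum.cong refl) (auto simp: indicator_def)
      also have "\<dots> = indicator D x *\<^sub>R (cmod (f x))\<^sup>2"
        using i sub \<open>finite I\<close> by (auto simp: sum.delta indicator_def)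
      finally show ?thesis by simp
    qed (auto intro!: sum_nonpos simp: indicator_def)
  qed
  then have "(LINT x|\<mu>. (\<Sum>i\<in>I. indicator (A i) x *\<^sub>R (cmod (f x))\<^sup>2)) \<le> energy \<mu> D f"
    unfolding energy_eq[OF DB]
    by (intro integral_mono_AE Bochner_Integration.integrable_sum energy_integrable bA D f)
  then show ?thesis
    by (simp only: sum_energy_eq[OF bA f])
qed

text \<open>By the Lindelof property countably many translates of a nonempty open set cover the group. If it
  were null, the whole group would be null.\<close>

lemma haar_open_pos:
  assumes "open P" "p \<in> P"
  shows "emeasure \<mu> P \<noteq> 0"
proof
  assume null: "emeasure \<mu> P = 0"
  let ?F = "range (\<lambda>t. (+) t ` P)"
  have cover: "\<Union>?F = UNIV"
  proof (intro set_eqI iffI UNIV_I)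
    fix y
    have "y \<in> (+) (y - p) ` P" using assms(2) by (intro image_eqI[of _ _ p]) auto
    then show "y \<in> \<Union>?F" by blast
  qed
  have "open S" if "S \<in> ?F" for S using that open_translate[OF assms(1)] by blast
  then obtain F' where F': "F' \<subseteq> ?F" "countable F'" "\<Union>F' = \<Union>?F"
    by (rule Lindelof)
  have "S \<in> null_sets \<mu>" if "S \<in> F'" for S
    using that F'(1) null emeasure_translate[of P] borel_translate[of P] assms(1)
    by (auto simp: null_sets_def)
  then have "(\<Union>S\<in>F'. S) \<in> null_sets \<mu>"
    using F'(2) by (intro null_sets_UN') auto
  then show False
    using haar F'(3) cover by (simp add: null_sets_def haar_measure_def)
qed

end

section \<open>Finite sums of characters\<close>

lemma characterD:
  assumes "h \<in> characters"
  shows "continuous_on UNIV h" "cmod (h x) = 1" "h (x + y) = h x * h y"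
  using assms by (auto simp: characters_def)

text \<open>The coefficients are indexed by the characters themselves, as the set \<open>F\<close> plays the role of the
  index set of the family.\<close>

definition char_sum :: "('a \<Rightarrow> complex) set \<Rightarrow> (('a \<Rightarrow> complex) \<Rightarrow> complex) \<Rightarrow> 'a \<Rightarrow> complex" where
  "char_sum F c x = (\<Sum>h\<in>F. c h * h x)"

lemma continuous_on_char_sum:
  assumes "F \<subseteq> characters"
  shows "continuous_on UNIV (char_sum F c)"
  unfolding char_sum_def[abs_def] using assms
  by (intro continuous_intros characterD) auto

lemma char_sum_translate:
  assumes "F \<subseteq> characters"
  shows "char_sum F c (t + x) = char_sum F (\<lambda>h. c h * h t) x"
  unfolding char_sum_def using assms
  by (intro sum.cong refl) (auto simp: characterD(3) mult.assoc)

text \<open>Characters that agree at \<open>t\<close> share the eigenvalue of the translation by \<open>t\<close>, so their sums are again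
  eigenfunctions; in particular the modulus of such a sum is invariant under \<open>t\<close>.\<close>

lemma char_sum_eigenfunction:
  assumes "F \<subseteq> characters" and "\<And>h. h \<in> F \<Longrightarrow> h t = a"
  shows "char_sum F c (t + x) = a * char_sum F c x"
  unfolding char_sum_def sum_distrib_left using assms
  by (intro sum.cong refl) (auto simp: characterD(3) mult_ac)

context
  fixes \<mu> :: "'a::{polish_space, topological_ab_group_add} measure"
  assumes haar: "haar_measure \<mu>"
begin

text \<open>The upper Riesz bound is inherited by every translate \<open>t + \<Omega>\<close>: moving the translation into the
  sum replaces \<open>c h\<close> by \<open>c h * h t\<close>, which has the same modulus. Covering \<open>D\<close> by translates costs a
  factor equal to their number.\<close>

lemma energy_char_sum_cover:
  fixes K :: real
  assumes upper: "\<And>c. energy \<mu> \<Omega> (char_sum F c) \<le> K * (\<Sum>h\<in>F. (cmod (c h))\<^sup>2)"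
    and F: "F \<subseteq> characters" and \<Omega>: "bounded_borel \<Omega>"
    and "finite T" and D: "D \<in> sets borel" "D \<subseteq> (\<Union>t\<in>T. (+) t ` \<Omega>)"
  shows "energy \<mu> D (char_sum F c) \<le> card T * K * (\<Sum>h\<in>F. (cmod (c h))\<^sup>2)"
proof -
  have "energy \<mu> D (char_sum F c) \<le> (\<Sum>t\<in>T. energy \<mu> ((+) t ` \<Omega>) (char_sum F c))"
    by (intro energy_le_sum_cover[OF haar] bounded_borel_translate \<Omega> D \<open>finite T\<close>
        continuous_on_char_sum F)
  also have "\<dots> \<le> (\<Sum>t\<in>T. K * (\<Sum>h\<in>F. (cmod (c h))\<^sup>2))"
  proof (rule sum_mono)
    fix t
    have "energy \<mu> ((+) t ` \<Omega>) (char_sum F c) = energy \<mu> \<Omega> (char_sum F (\<lambda>h. c h * h t))"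
      using \<Omega> energy_translate[OF haar _ continuous_on_char_sum[OF F], of \<Omega> t c]
      by (simp add: bounded_borel_def char_sum_translate[OF F])
    also have "\<dots> \<le> K * (\<Sum>h\<in>F. (cmod (c h * h t))\<^sup>2)"
      by (rule upper)
    also have "(\<Sum>h\<in>F. (cmod (c h * h t))\<^sup>2) = (\<Sum>h\<in>F. (cmod (c h))\<^sup>2)"
      using F by (intro sum.cong refl) (auto simp: norm_mult characterD(2))
    finally show "energy \<mu> ((+) t ` \<Omega>) (char_sum F c) \<le> K * (\<Sum>h\<in>F. (cmod (c h))\<^sup>2)" .
  qed
  finally show ?thesis by simp
qed

lemma energy_invariant_packing:
  assumes "finite T" and R: "R \<in> sets borel" and f: "continuous_on UNIV f"
    and inv: "\<And>t x. t \<in> T \<Longrightarrow> cmod (f (t + x)) = cmod (f x)"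
    and null: "\<And>s t. s \<in> T \<Longrightarrow> t \<in> T \<Longrightarrow> s \<noteq> t \<Longrightarrow> emeasure \<mu> ((+) s ` R \<inter> (+) t ` R) = 0"
    and D: "bounded_borel D" and sub: "\<And>t. t \<in> T \<Longrightarrow> (+) t ` R \<subseteq> D"
  shows "card T * energy \<mu> R f \<le> energy \<mu> D f"
proof -
  have "card T * energy \<mu> R f = (\<Sum>t\<in>T. energy \<mu> ((+) t ` R) f)"
  proof -
    have "energy \<mu> ((+) t ` R) f = energy \<mu> R f" if "t \<in> T" for t
      unfolding energy_translate[OF haar R f] by (intro energy_cong inv that)
    then show ?thesis by simp
  qed
  also have "\<dots> \<le> energy \<mu> D f"
    by (intro sum_energy_le_packing[OF haar] \<open>finite T\<close> borel_translate R sub null D f)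
  finally show ?thesis .
qed

text \<open>Eigenfunctions of a unitary operator with distinct eigenvalues are orthogonal; the operator here is
  the translation by \<open>t\<close> on \<open>L\<^sup>2(E)\<close>.\<close>

lemma L2_inner_eigenfunctions:
  assumes E: "E \<in> sets borel" "(+) t ` E = E"
    and f: "continuous_on UNIV f" "\<And>x. f (t + x) = a * f x"
    and g: "continuous_on UNIV g" "\<And>x. g (t + x) = b * g x"
    and b: "cmod b = 1" and ab: "a \<noteq> b"
  shows "L2_inner (restrict_space \<mu> E) f g = 0"
proof -
  let ?I = "L2_inner (restrict_space \<mu> E) f g"
  have "(\<lambda>x. f x * cnj (g x)) \<in> borel_measurable borel"
    by (intro borel_measurable_continuous_onI continuous_intros f g)
  from integral_translate[OF haar E(1) this, of t]
  have "?I = (LINT x|restrict_space \<mu> E. (a * cnj b) * (f x * cnj (g x)))"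
    by (simp add: L2_inner_def E(2) f(2) g(2) mult_ac)
  then have "?I = (a * cnj b) * ?I"
    by (simp add: L2_inner_def)
  moreover have "a * cnj b \<noteq> 1"
  proof
    assume "a * cnj b = 1"
    moreover have "cnj b * b = 1"
      using b by (simp add: complex_norm_square[symmetric] mult.commute)
    ultimately have "a = b" by (metis mult.assoc mult_1_left mult_1_right)
    with ab show False ..
  qed
  ultimately show ?thesis by (simp add: mult_cancel_right1)
qed

text \<open>Characters with different restrictions to \<open>H\<close> are separated by some \<open>t \<in> H\<close>, and translation by \<open>t\<close>
  preserves \<open>E\<close>. The classes of characters that agree on \<open>H\<close> therefore span mutually orthogonal spaces
  in \<open>L\<^sup>2(E)\<close>, and by Pythagoras a lower bound that is uniform over the classes holds for all sums.\<close>

lemma char_sum_lower_bound_from_classes: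
  assumes E: "bounded_borel E" "\<And>t. t \<in> H \<Longrightarrow> (+) t ` E = E"
    and F: "finite F" "F \<subseteq> characters"
    and class_bound: "\<And>F'. F' \<subseteq> F \<Longrightarrow> (\<And>h h' t. h \<in> F' \<Longrightarrow> h' \<in> F' \<Longrightarrow> t \<in> H \<Longrightarrow> h t = h' t)
      \<Longrightarrow> (\<Sum>h\<in>F'. (cmod (c h))\<^sup>2) \<le> L * energy \<mu> E (char_sum F' c)"
  shows "(\<Sum>h\<in>F. (cmod (c h))\<^sup>2) \<le> L * energy \<mu> E (char_sum F c)"
proof -
  let ?r = "\<lambda>h. restrict h H"
  let ?F = "\<lambda>y. {h. h \<in> F \<and> ?r h = y}"
  let ?Y = "?r ` F"
  have Fy: "?F y \<subseteq> characters" for y using F by blast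
  have val: "h t = y t" if "h \<in> ?F y" "t \<in> H" for h t y
    using that by auto
  have split: "char_sum F c x = (\<Sum>y\<in>?Y. char_sum (?F y) c x)" for x
    unfolding char_sum_def by (rule sum.image_gen[OF F(1)])
  have "L2_inner (restrict_space \<mu> E) (char_sum (?F y) c) (char_sum (?F y') c) = 0"
    if y: "y \<in> ?Y" "y' \<in> ?Y" "y \<noteq> y'" for y y'
  proof -
    obtain t where t: "t \<in> H" "y t \<noteq> y' t"
      using y by (auto simp: restrict_def fun_eq_iff split: if_splits)
    obtain h where "h \<in> F" "y' = restrict h H" using y(2) by blast
    then have "cmod (y' t) = 1"
      using t(1) F(2) characterD(2)[of h t] by auto
    moreover have "E \<in> sets borel" using E(1) by (simp add: bounded_borel_def)
    ultimately show ?thesis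
      by (intro L2_inner_eigenfunctions[OF _ E(2)[OF t(1)] _ _ _ _ _ t(2)]
          continuous_on_char_sum char_sum_eigenfunction Fy val t(1))
  qed
  then have "energy \<mu> E (char_sum F c) = (\<Sum>y\<in>?Y. energy \<mu> E (char_sum (?F y) c))"
    unfolding energy_def split[abs_def] using F(1)
    by (intro L2_pythagoras L2_continuous[OF haar E(1)] continuous_on_char_sum Fy) auto
  moreover have "(\<Sum>h\<in>F. (cmod (c h))\<^sup>2) = (\<Sum>y\<in>?Y. \<Sum>h\<in>?F y. (cmod (c h))\<^sup>2)"
    by (rule sum.image_gen[OF F(1)])
  moreover have "\<dots> \<le> (\<Sum>y\<in>?Y. L * energy \<mu> E (char_sum (?F y) c))"
  proof (rule sum_mono)
    fix y
    show "(\<Sum>h\<in>?F y. (cmod (c h))\<^sup>2) \<le> L * energy \<mu> E (char_sum (?F y) c)"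
    proof (rule class_bound)
      show "h t = h' t" if "h \<in> ?F y" "h' \<in> ?F y" "t \<in> H" for h h' t
        by (simp only: val[OF that(1,3)] val[OF that(2,3)])
    qed blast
  qed
  ultimately show ?thesis by (simp add: sum_distrib_left)
qed

text \<open>If many disjoint translates of \<open>R\<close> by elements of \<open>H\<close> fit into a bounded set \<open>D\<close>, then the Riesz
  sequence \<open>\<Lambda>\<close> of \<open>\<Omega>\<close> is still a Riesz sequence on \<open>E\<close>. It is enough to see this within one class of
  characters agreeing on \<open>H\<close>. There the sum \<open>f\<close> has \<open>H\<close>-invariant modulus, so that, with
  \<open>s = \<Sum> \<bar>c h\<bar>\<^sup>2\<close>, packing and covering give \<open>card T * energy \<mu> R f \<le> card S * K * s\<close>. For \<open>card T\<close> above
  the stated threshold this makes the contribution of \<open>R\<close> to the lower Riesz bound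
  \<open>s \<le> K * energy \<mu> \<Omega> f\<close> at most \<open>s / 2\<close>, and the other half has to come from \<open>E\<close>.\<close>

lemma char_sum_lower_bound_off_packed_part:
  fixes K :: real
  assumes \<Omega>: "bounded_borel \<Omega>" "\<Omega> \<subseteq> E \<union> R" and E: "bounded_borel E" and R: "bounded_borel R"
    and inv: "\<And>t. t \<in> H \<Longrightarrow> (+) t ` E = E"
    and T: "T \<subseteq> H" "finite T"
      "\<And>s t. s \<in> T \<Longrightarrow> t \<in> T \<Longrightarrow> s \<noteq> t \<Longrightarrow> emeasure \<mu> ((+) s ` R \<inter> (+) t ` R) = 0"
    and D: "bounded_borel D" "\<And>t. t \<in> T \<Longrightarrow> (+) t ` R \<subseteq> D"
    and S: "finite S" "D \<subseteq> (\<Union>s\<in>S. (+) s ` \<Omega>)"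
    and \<Lambda>: "\<Lambda> \<subseteq> characters" and "K > 0"
    and upper: "\<And>F c. finite F \<Longrightarrow> F \<subseteq> \<Lambda> \<Longrightarrow>
      energy \<mu> \<Omega> (char_sum F c) \<le> K * (\<Sum>h\<in>F. (cmod (c h))\<^sup>2)"
    and lower: "\<And>F c. finite F \<Longrightarrow> F \<subseteq> \<Lambda> \<Longrightarrow>
      (\<Sum>h\<in>F. (cmod (c h))\<^sup>2) \<le> K * energy \<mu> \<Omega> (char_sum F c)"
    and large: "card T > 2 * K\<^sup>2 * card S"
    and F: "finite F" "F \<subseteq> \<Lambda>"
  shows "(\<Sum>h\<in>F. (cmod (c h))\<^sup>2) \<le> 2 * K * energy \<mu> E (char_sum F c)"
proof (rule char_sum_lower_bound_from_classes[OF E inv F(1)])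
  show "F \<subseteq> characters" using F \<Lambda> by blast
  fix F' assume F': "F' \<subseteq> F"
    and same: "\<And>h h' t. h \<in> F' \<Longrightarrow> h' \<in> F' \<Longrightarrow> t \<in> H \<Longrightarrow> h t = h' t"
  have fin: "finite F'" and sub: "F' \<subseteq> \<Lambda>" and chars: "F' \<subseteq> characters"
    using F' F \<Lambda> finite_subset by blast+
  let ?f = "char_sum F' c"
  let ?s = "\<Sum>h\<in>F'. (cmod (c h))\<^sup>2"
  have cont: "continuous_on UNIV ?f" by (rule continuous_on_char_sum[OF chars])
  have f_inv: "cmod (?f (t + x)) = cmod (?f x)" if "t \<in> T" for t x
  proof (cases "F' = {}")
    case True
    then show ?thesis by (simp add: char_sum_def)
  next
    case False
    then obtain k where k: "k \<in> F'" by blast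
    have "?f (t + x) = k t * ?f x"
      using same k that T by (intro char_sum_eigenfunction chars) blast
    then show ?thesis
      using k chars characterD(2)[of k t] by (auto simp: norm_mult)
  qed
  have "card T * energy \<mu> R ?f \<le> energy \<mu> D ?f"
    using R by (intro energy_invariant_packing T cont f_inv D) (auto simp: bounded_borel_def)
  also have "\<dots> \<le> card S * K * ?s"
    using D(1) by (intro energy_char_sum_cover[OF upper] fin sub chars \<Omega> S)
      (auto simp: bounded_borel_def)
  finally have packed: "card T * energy \<mu> R ?f \<le> card S * K * ?s" .
  have "?s \<ge> 0" by (simp add: sum_nonneg)
  \<comment> \<open>The threshold on the cardinality of \<open>T\<close> is chosen so that the part of the lower Riesz bound
    coming from \<open>R\<close> can be absorbed into the left-hand side, at the cost of the factor two.\<close>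
  have tail: "2 * K * energy \<mu> R ?f \<le> ?s"
  proof -
    have "0 \<le> 2 * K\<^sup>2 * card S" by simp
    with large have "card T > 0" by linarith
    have "card T * (2 * K * energy \<mu> R ?f) = 2 * K * (card T * energy \<mu> R ?f)"
      by simp
    also have "\<dots> \<le> 2 * K * (card S * K * ?s)"
      using packed \<open>K > 0\<close> by (intro mult_left_mono) auto
    also have "\<dots> = (2 * K\<^sup>2 * card S) * ?s"
      by (simp add: power2_eq_square)
    also have "\<dots> \<le> card T * ?s"
      using large \<open>?s \<ge> 0\<close> by (intro mult_right_mono) auto
    finally show ?thesis using \<open>card T > 0\<close> by simp
  qed
  \<comment> \<open>Indexing by truth values avoids the question whether \<open>E\<close> and \<open>R\<close> are distinct.\<close>
  have "energy \<mu> \<Omega> ?f \<le> (\<Sum>i\<in>{True, False}. energy \<mu> (if i then E else R) ?f)"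
    using \<Omega> E R by (intro energy_le_sum_cover[OF haar] cont) (auto simp: bounded_borel_def)
  then have "K * energy \<mu> \<Omega> ?f \<le> K * (energy \<mu> E ?f + energy \<mu> R ?f)"
    using \<open>K > 0\<close> by (intro mult_left_mono) auto
  then show "?s \<le> 2 * K * energy \<mu> E ?f"
    using lower[OF fin sub, of c] tail by (simp add: algebra_simps)
qed

text \<open>The function out of reach is the indicator \<open>g\<close> of \<open>P\<close>, which vanishes on \<open>E\<close>. If \<open>r = g - f\<close> with a sum
  \<open>f\<close> of characters, then \<open>f\<close> and \<open>r\<close> have the same energy on \<open>E\<close>, so the lower bound on \<open>E\<close> followed by
  the upper bound on \<open>\<Omega>\<close> controls \<open>f\<close> on \<open>\<Omega>\<close> by \<open>r\<close>. Thus \<open>g = r + f\<close> is controlled by \<open>r\<close>, which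
  keeps \<open>r\<close> away from zero.\<close>

lemma incomplete_if_lower_bound_on_part:
  fixes K L :: real
  assumes \<Omega>: "bounded_borel \<Omega>" and E: "E \<in> sets borel" "E \<subseteq> \<Omega>"
    and P: "open P" "compact P" "P \<noteq> {}" "P \<subseteq> \<Omega>" "P \<inter> E = {}"
    and \<Lambda>: "\<Lambda> \<subseteq> characters" and "K > 0" "L > 0"
    and upper: "\<And>F c. finite F \<Longrightarrow> F \<subseteq> \<Lambda> \<Longrightarrow>
      energy \<mu> \<Omega> (char_sum F c) \<le> K * (\<Sum>h\<in>F. (cmod (c h))\<^sup>2)"
    and lower: "\<And>F c. finite F \<Longrightarrow> F \<subseteq> \<Lambda> \<Longrightarrow>
      (\<Sum>h\<in>F. (cmod (c h))\<^sup>2) \<le> L * energy \<mu> E (char_sum F c)"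
  shows "\<exists>g \<epsilon>. g \<in> L2 (restrict_space \<mu> \<Omega>) \<and> \<epsilon> > 0 \<and> (\<forall>F c. finite F \<longrightarrow> F \<subseteq> \<Lambda> \<longrightarrow>
      \<epsilon> \<le> L2_norm (restrict_space \<mu> \<Omega>) (\<lambda>x. g x - char_sum F c x))"
proof -
  define g :: "'a \<Rightarrow> complex" where "g = (\<lambda>x. if x \<in> P then 1 else 0)"
  \<comment> \<open>\<open>P\<close> is both open and closed, so that its indicator is continuous.\<close>
  have "continuous_on (P \<union> - P) g"
    unfolding g_def
    by (rule continuous_on_cases) (use P compact_imp_closed in \<open>auto simp: closed_def\<close>)
  then have g: "continuous_on UNIV g" by simp
  have P_borel: "P \<in> sets borel" using P(1) by simp
  have "energy \<mu> P g = measure \<mu> P"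
  proof -
    have "energy \<mu> P g = (LINT x|\<mu>. indicator P x)"
      unfolding energy_eq[OF haar P_borel]
      by (intro Bochner_Integration.integral_cong) (auto simp: g_def indicator_def)
    then show ?thesis using haar by simp
  qed
  moreover have "emeasure \<mu> P < \<infinity>"
    using haar P(2) P_borel unfolding haar_measure_def by blast
  moreover have "emeasure \<mu> P \<noteq> 0"
    using haar_open_pos[OF haar P(1)] P(3) by blast
  ultimately have "energy \<mu> P g > 0"
    by (simp add: measure_def enn2real_positive_iff zero_less_iff_neq_zero)
  then have pos: "energy \<mu> \<Omega> g > 0"
    using energy_mono[OF haar \<Omega> P_borel P(4) g] by linarith
  define m where "m = energy \<mu> \<Omega> g"
  define q where "q = 2 + 2 * K * L"
  have "q > 0" using \<open>K > 0\<close> \<open>L > 0\<close> by (simp add: q_def add_pos_pos)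
  have "sqrt (m / q) \<le> L2_norm (restrict_space \<mu> \<Omega>) (\<lambda>x. g x - char_sum F c x)"
    if F: "finite F" "F \<subseteq> \<Lambda>" for F c
  proof -
    let ?f = "char_sum F c"
    have f: "continuous_on UNIV ?f" using F \<Lambda> by (intro continuous_on_char_sum) blast
    let ?r = "\<lambda>x. g x - ?f x"
    have r: "continuous_on UNIV ?r" by (intro continuous_intros f g)
    have "energy \<mu> E ?f = energy \<mu> E ?r"
      using P(5) by (intro energy_cong) (auto simp: g_def)
    also have "\<dots> \<le> energy \<mu> \<Omega> ?r"
      by (intro energy_mono[OF haar \<Omega>] E r)
    finally have "L * energy \<mu> E ?f \<le> L * energy \<mu> \<Omega> ?r"
      using \<open>L > 0\<close> by (intro mult_left_mono) auto
    with lower[OF F, of c] have "(\<Sum>h\<in>F. (cmod (c h))\<^sup>2) \<le> L * energy \<mu> \<Omega> ?r" by linarith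
    then have "K * (\<Sum>h\<in>F. (cmod (c h))\<^sup>2) \<le> K * (L * energy \<mu> \<Omega> ?r)"
      using \<open>K > 0\<close> by (intro mult_left_mono) auto
    with upper[OF F, of c] have f_le: "energy \<mu> \<Omega> ?f \<le> K * L * energy \<mu> \<Omega> ?r" by simp
    have "energy \<mu> \<Omega> (\<lambda>x. ?r x + ?f x) \<le> 2 * energy \<mu> \<Omega> ?r + 2 * energy \<mu> \<Omega> ?f"
      unfolding energy_def by (intro L2_norm_add_power2_le L2_continuous[OF haar \<Omega>] r f)
    with f_le have "m \<le> q * energy \<mu> \<Omega> ?r"
      by (simp add: m_def q_def algebra_simps)
    then have "m / q \<le> (L2_norm (restrict_space \<mu> \<Omega>) ?r)\<^sup>2"
      using \<open>q > 0\<close> by (simp add: divide_le_eq energy_def mult.commute)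
    then show ?thesis by (rule real_le_lsqrt[OF L2_norm_nonneg])
  qed
  moreover have "sqrt (m / q) > 0" using pos \<open>q > 0\<close> by (simp add: m_def)
  ultimately show ?thesis
    using L2_continuous[OF haar \<Omega> g] by blast
qed

end

section \<open>Large translation numbers exclude Riesz bases of characters\<close>

text \<open>The supremum may be infinite, and even a single translation set may be infinite; passing to a
  subset of prescribed size covers all cases.\<close>

lemma translation_number_greaterD:
  assumes "enat N < translation_number \<mu> B S"
  obtains T where "T \<subseteq> B" "finite T" "card T = N"
    "\<And>s t. s \<in> T \<Longrightarrow> t \<in> T \<Longrightarrow> s \<noteq> t \<Longrightarrow> emeasure \<mu> ((+) s ` S \<inter> (+) t ` S) = 0"
proof -
  obtain T' where T': "T' \<subseteq> B" "translation_set \<mu> S T'" "enat N < cardinality T'"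
    using assms unfolding translation_number_def less_SUP_iff by blast
  obtain T where "T \<subseteq> T'" "finite T" "card T = N"
  proof (cases "finite T'")
    case True
    then have "N \<le> card T'" using T'(3) by (simp add: cardinality_def)
    then show thesis using that obtain_subset_with_card_n by metis
  next
    case False
    then show thesis using that infinite_arbitrarily_large by metis
  qed
  then show thesis
    using T'(1,2) by (intro that[of T]) (auto simp: translation_set_def subset_iff)
qed

lemma limsup_enat_infinityD:
  assumes "limsup X = (\<infinity>::enat)"
  obtains n where "n \<ge> m" "enat N < X n"
proof (rule ccontr)
  assume "\<not> thesis"
  then have "\<And>n. n \<ge> m \<Longrightarrow> X n \<le> enat N" using that by (meson not_le)
  then have "eventually (\<lambda>n. X n \<le> enat N) sequentially"
    unfolding eventually_sequentially by blast
  from Limsup_bounded[OF this] assms show False by simp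
qed

theorem proposition1p4:
  fixes \<mu> :: "'a::{polish_space, topological_ab_group_add} measure"
    and \<Omega> :: "'a set" and x :: "nat \<Rightarrow> 'a" and B :: "nat \<Rightarrow> 'a set"
  assumes "locally_compact_space (euclidean :: 'a topology)"
    and "non_archimedean TYPE('a)"
    and "(euclidean :: 'a topology) \<noteq> discrete_topology UNIV"
    and "haar_measure \<mu>"
    and "open \<Omega>"
    and "\<exists>K. compact K \<and> \<Omega> \<subseteq> K"
    and "\<And>n. n \<ge> 1 \<Longrightarrow> add_subgroup (B n) \<and> compact (B n) \<and> open (B n)"
    and "disjoint_family_on (\<lambda>n. (+) (x n) ` B n) {1..}"
    and "\<Omega> = (\<Union>n\<in>{1..}. (+) (x n) ` B n)"
    and "\<And>n. n \<ge> 1 \<Longrightarrow> B (n + 1) \<subseteq> B n"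
    and "limsup (\<lambda>n. translation_number \<mu> (B n) (\<Union>k\<in>{n+1..}. (+) (x k) ` B k)) = \<infinity>"
  shows "\<not> (\<exists>\<Lambda>. \<Lambda> \<subseteq> characters \<and> forms_riesz_basis \<mu> \<Omega> \<Lambda>)"
proof
  note haar = assms(4) and B = assms(7) and disj = assms(8) and \<Omega>_eq = assms(9)
  assume "\<exists>\<Lambda>. \<Lambda> \<subseteq> characters \<and> forms_riesz_basis \<mu> \<Omega> \<Lambda>"
  then obtain \<Lambda> where \<Lambda>: "\<Lambda> \<subseteq> characters"
    and riesz: "L2_riesz_basis (restrict_space \<mu> \<Omega>) \<Lambda> (\<lambda>h. h)"
    unfolding forms_riesz_basis_def by blast
  from L2_riesz_basis_finite_sums[OF riesz] obtain K where K: "K > 0"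
    and upper: "\<And>F c. finite F \<Longrightarrow> F \<subseteq> \<Lambda> \<Longrightarrow>
      energy \<mu> \<Omega> (char_sum F c) \<le> K * (\<Sum>h\<in>F. (cmod (c h))\<^sup>2)"
    and lower: "\<And>F c. finite F \<Longrightarrow> F \<subseteq> \<Lambda> \<Longrightarrow>
      (\<Sum>h\<in>F. (cmod (c h))\<^sup>2) \<le> K * energy \<mu> \<Omega> (char_sum F c)"
    and complete: "\<And>g \<epsilon>. g \<in> L2 (restrict_space \<mu> \<Omega>) \<Longrightarrow> \<epsilon> > 0 \<Longrightarrow>
      \<exists>F c. finite F \<and> F \<subseteq> \<Lambda> \<and> L2_norm (restrict_space \<mu> \<Omega>) (\<lambda>x. g x - char_sum F c x) < \<epsilon>"
    unfolding energy_def char_sum_def[abs_def] by blast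

  obtain K0 where K0: "compact K0" "\<Omega> \<subseteq> K0" using assms(6) by blast
  have \<Omega>: "bounded_borel \<Omega>"
    using K0 \<open>open \<Omega>\<close> by (auto simp: bounded_borel_def)
  have B0: "0 \<in> B n" if "n \<ge> 1" for n
    using B[OF that] by (simp add: add_subgroup_def)
  have "x 1 \<in> \<Omega>"
    unfolding \<Omega>_eq using B0[of 1] by (auto intro!: bexI[of _ 1] image_eqI[of _ _ 0])

  \<comment> \<open>For every \<open>n \<ge> 1\<close> the translates of \<open>\<Omega>\<close> by elements of \<open>B n\<close> stay inside \<open>D\<close>. The number of translates
    of \<open>\<Omega>\<close> that cover \<open>D\<close> is fixed here, before \<open>n\<close> is chosen.\<close>
  define D where "D = (\<lambda>(a, b). a + b) ` (K0 \<times> B 1)"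
  have "compact D"
    unfolding D_def case_prod_beta using K0(1) B[of 1]
    by (intro compact_continuous_image compact_Times continuous_intros) auto
  have "D \<subseteq> (\<Union>s\<in>UNIV. (+) s ` \<Omega>)"
  proof
    fix y
    have "y \<in> (+) (y - x 1) ` \<Omega>" using \<open>x 1 \<in> \<Omega>\<close> by (intro image_eqI[of _ _ "x 1"]) auto
    then show "y \<in> (\<Union>s\<in>UNIV. (+) s ` \<Omega>)" by blast
  qed
  then obtain S where S: "finite S" "D \<subseteq> (\<Union>s\<in>S. (+) s ` \<Omega>)"
    by (rule compactE_image[OF \<open>compact D\<close> open_translate[OF \<open>open \<Omega>\<close>]])

  obtain N :: nat where N: "N > 2 * K\<^sup>2 * card S" using reals_Archimedean2 by blast
  obtain n where n: "n \<ge> 1"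
    and N_less: "enat N < translation_number \<mu> (B n) (\<Union>k\<in>{n+1..}. (+) (x k) ` B k)"
    using limsup_enat_infinityD[OF assms(11)] by blast
  define E where "E = (\<Union>k\<in>{1..n}. (+) (x k) ` B k)"
  define R where "R = (\<Union>k\<in>{n+1..}. (+) (x k) ` B k)"
  obtain T where T: "T \<subseteq> B n" "finite T" "card T = N"
    "\<And>s t. s \<in> T \<Longrightarrow> t \<in> T \<Longrightarrow> s \<noteq> t \<Longrightarrow> emeasure \<mu> ((+) s ` R \<inter> (+) t ` R) = 0"
    using translation_number_greaterD[OF N_less] unfolding R_def by blast

  have "{1..} = {1..n} \<union> {n+1..}" using n by auto
  then have \<Omega>_split: "\<Omega> = E \<union> R" unfolding \<Omega>_eq E_def R_def by (metis UN_Un)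
  have "open E" "open R"
    unfolding E_def R_def by (intro open_UN ballI open_translate; use B in simp)+
  then have E_borel: "E \<in> sets borel" and R_borel: "R \<in> sets borel" by simp_all
  have E: "bounded_borel E" using bounded_borel_subset[OF \<Omega> E_borel] \<Omega>_split by simp
  have R: "bounded_borel R" using bounded_borel_subset[OF \<Omega> R_borel] \<Omega>_split by simp
  have B_mono: "B n \<subseteq> B k" if "1 \<le> k" "k \<le> n" for k
    using that(2)
  proof (induction n rule: dec_induct)
    case (step m)
    have "B (m + 1) \<subseteq> B m" using step.hyps(1) that(1) by (intro assms(10)) linarith
    then show ?case using step.IH by simp
  qed simp
  have inv: "(+) t ` E = E" if "t \<in> B n" for t
  proof (rule translate_eq_if_invariant[OF _ _ that])
    show "add_subgroup (B n)" using B n by blast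
    show "(+) h ` E \<subseteq> E" if "h \<in> B n" for h
    proof clarsimp
      fix y assume "y \<in> E"
      then obtain k b where k: "1 \<le> k" "k \<le> n" "b \<in> B k" "y = x k + b"
        unfolding E_def by auto
      then have "h + b \<in> B k"
        using B[of k] B_mono[of k] that by (auto simp: add_subgroup_def)
      moreover have "h + y = x k + (h + b)" using k(4) by (simp add: add.left_commute)
      ultimately show "h + y \<in> E" unfolding E_def using k(1,2) by (intro UN_I[of k]) simp_all
    qed
  qed
  have RD: "(+) t ` R \<subseteq> D" if "t \<in> T" for t
  proof
    fix y assume "y \<in> (+) t ` R"
    then obtain r where r: "r \<in> R" "y = t + r" by blast
    have "(r, t) \<in> K0 \<times> B 1"
      using r(1) \<Omega>_split K0(2) that T(1) B_mono[of 1] n by auto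
    moreover have "y = (case (r, t) of (a, b) \<Rightarrow> a + b)" using r(2) by (simp add: add.commute)
    ultimately show "y \<in> D" unfolding D_def by (rule rev_image_eqI)
  qed
  have lower_E: "(\<Sum>h\<in>F. (cmod (c h))\<^sup>2) \<le> 2 * K * energy \<mu> E (char_sum F c)"
    if F: "finite F" "F \<subseteq> \<Lambda>" for F c
  proof (rule char_sum_lower_bound_off_packed_part[OF haar \<Omega> _ E R inv T(1,2,4) _ RD S \<Lambda> K
        upper lower _ F])
    show "\<Omega> \<subseteq> E \<union> R" using \<Omega>_split by simp
    show "bounded_borel D" by (rule compact_bounded_borel[OF \<open>compact D\<close>])
    show "2 * K\<^sup>2 * card S < card T" using N T(3) by simp
  qed

  define P where "P = (+) (x (n + 1)) ` B (n + 1)"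
  have "P \<subseteq> R" unfolding P_def R_def by auto
  then have P_sub: "P \<subseteq> \<Omega>" using \<Omega>_split by blast
  have "P \<inter> (+) (x k) ` B k = {}" if "k \<in> {1..n}" for k
    unfolding P_def using disjoint_family_onD[OF disj, of "n + 1" k] that by simp
  then have P_E: "P \<inter> E = {}" unfolding E_def by blast
  have P: "open P" "compact P" "P \<noteq> {}"
    unfolding P_def using B[of "n + 1"] B0[of "n + 1"]
    by (simp_all add: open_translate compact_translate) blast
  have "E \<subseteq> \<Omega>" "2 * K > 0" using \<Omega>_split K by auto
  from incomplete_if_lower_bound_on_part[OF haar \<Omega> E_borel this(1) P P_sub P_E \<Lambda> K this(2)
      upper lower_E]
  obtain g \<epsilon> where "g \<in> L2 (restrict_space \<mu> \<Omega>)" "\<epsilon> > 0"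
    and far: "\<And>F c. finite F \<Longrightarrow> F \<subseteq> \<Lambda> \<Longrightarrow>
      \<epsilon> \<le> L2_norm (restrict_space \<mu> \<Omega>) (\<lambda>x. g x - char_sum F c x)"
    by blast
  from complete[OF this(1,2)] far show False by (meson not_le)
qed

end
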